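(* Let $s > r \geq 3$ and $t \geq 2(s-2)+1$ be integers. There is a constant $C_{s,r,t}$, depending only on $r$, $s$ and $t$, such that for every $n \geq 2(s-2)+2t$, \[ \mathrm{sat}_t(n, K_r, K_s) \leq \binom{s-2}{r-1} 2^{r-1} n + C_{s,r,t}, \] that is, there exists an $n$-vertex $K_s$-saturated graph with minimum degree exactly $t$ containing at most $\binom{s-2}{r-1}2^{r-1}n + C_{s,r,t}$ copies of $K_r$.
   Context: A graph $G$ is $K_s$-saturated if $G$ contains no copy of $K_s$ but adding any edge between two nonadjacent vertices of $G$ creates a copy of $K_s$. For graphs $H$, $F$ and integers $n,t$, $\mathrm{sat}_t(n,H,F)$ is the minimum number of copies of $H$ in an $n$-vertex $F$-saturated graph with minimum degree $t$. *)

theory Defs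
  imports "HOL-Library.Extended_Nat" "Graph_Theory.Graph_Theory"
begin

text \<open>
  Simple graphs are represented by \<^locale>\<open>pair_graph\<close>: finite, symmetric, loop-free digraphs whose
  arcs are ordered pairs. An undirected edge \<open>uv\<close> is the pair of arcs \<open>(u, v)\<close> and \<open>(v, u)\<close>, so the
  degree of a vertex is its out-degree.
\<close>

definition complete_graph :: "nat \<Rightarrow> nat pair_pre_digraph" where
  "complete_graph k = \<lparr>pverts = {..<k}, parcs = {(u, v). u < k \<and> v < k \<and> u \<noteq> v}\<rparr>"

lemma complete_digraph_complete_graph: "complete_digraph k (with_proj (complete_graph k))"
  by (auto simp: complete_digraph_pair_def complete_graph_def)

text \<open>The copies of \<open>H\<close> in \<open>G\<close> are the (not necessarily induced) subgraphs of \<open>G\<close> isomorphic to \<open>H\<close>.\<close>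

definition copies :: "'h pair_pre_digraph \<Rightarrow> 'a pair_pre_digraph \<Rightarrow> 'a pair_pre_digraph set" where
  "copies H G =
    {S. subgraph (with_proj S) (with_proj G) \<and> digraph_iso (with_proj H) (with_proj S)}"

definition add_edge :: "'a \<Rightarrow> 'a \<Rightarrow> 'a pair_pre_digraph \<Rightarrow> 'a pair_pre_digraph" where
  "add_edge u v G = \<lparr>pverts = pverts G, parcs = parcs G \<union> {(u, v), (v, u)}\<rparr>"

definition saturated :: "'f pair_pre_digraph \<Rightarrow> 'a pair_pre_digraph \<Rightarrow> bool" where
  "saturated F G \<longleftrightarrow>
    copies F G = {} \<and>
    (\<forall>u \<in> pverts G. \<forall>v \<in> pverts G.
       u \<noteq> v \<and> (u, v) \<notin> parcs G \<longrightarrow> copies F (add_edge u v G) \<noteq> {})"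

definition min_degree :: "'a pair_pre_digraph \<Rightarrow> nat" where
  "min_degree G = Min (out_degree (with_proj G) ` pverts G)"

text \<open>Every finite graph is isomorphic to one whose vertices are natural numbers.\<close>

definition sat_graphs :: "nat \<Rightarrow> nat \<Rightarrow> 'f pair_pre_digraph \<Rightarrow> nat pair_pre_digraph set" where
  "sat_graphs t n F =
    {G. pair_graph G \<and> card (pverts G) = n \<and> saturated F G \<and> min_degree G = t}"

text \<open>
  The minimum is taken in \<^typ>\<open>enat\<close>, where the infimum of the empty set is \<open>\<infinity>\<close>. A finite upper bound
  on \<open>sat\<close> thus entails that a graph of the required kind exists.
\<close>

definition sat :: "nat \<Rightarrow> nat \<Rightarrow> 'h pair_pre_digraph \<Rightarrow> 'f pair_pre_digraph \<Rightarrow> enat" where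
  "sat t n H F = (INF G \<in> sat_graphs t n F. enat (card (copies H G)))"

end

theory Submission
  imports Defs
begin

text \<open>
  Let \<open>k = s - 2\<close>. Take the complete \<open>k\<close>-partite graph with parts of size two as a core, join it to an
  independent set \<open>B\<close> of almost all vertices, and join \<open>B\<close> to a further set \<open>X\<close> of \<open>t - 2 * k\<close> vertices.
  A vertex of \<open>B\<close> has degree \<open>t\<close>, and as long as \<open>X\<close> is independent and not joined to the core, every
  \<open>K\<^sub>r\<close> through it consists of it and one of the \<open>(k choose (r - 1)) * 2 ^ (r - 1)\<close> cliques
  \<open>K\<^bsub>r-1\<^esub>\<close> of the core. A bounded number of witness vertices is added so that the graph stays
  \<open>K\<^sub>s\<close>-free, but each missing edge inside \<open>X\<close> or the core, between \<open>X\<close> and the core, or at a vertex of \<open>B\<close>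
  would complete a \<open>K\<^sub>s\<close>. Hence any maximal \<open>K\<^sub>s\<close>-free supergraph, which is automatically saturated, adds
  edges at witnesses only, and has boundedly many \<open>K\<^sub>r\<close> that avoid \<open>B\<close>. For the finitely many \<open>n\<close> that leave no
  room for the witnesses, a complete \<open>(k + 1)\<close>-partite graph with one part of size \<open>n - t\<close> serves.
\<close>

section \<open>Cliques and saturation for plain vertex and edge sets\<close>

definition cliques :: "'a set \<Rightarrow> 'a rel \<Rightarrow> nat \<Rightarrow> 'a set set" where
  "cliques V E m = {K. K \<subseteq> V \<and> card K = m \<and> pairwise (\<lambda>u v. (u, v) \<in> E) K}"

definition simple_graph :: "'a set \<Rightarrow> 'a rel \<Rightarrow> bool" where
  "simple_graph V E \<longleftrightarrow> finite V \<and> E \<subseteq> V \<times> V \<and> sym E \<and> irrefl E"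

definition clique_saturated :: "nat \<Rightarrow> 'a set \<Rightarrow> 'a rel \<Rightarrow> bool" where
  "clique_saturated s V E \<longleftrightarrow>
    cliques V E s = {} \<and>
    (\<forall>u\<in>V. \<forall>v\<in>V. u \<noteq> v \<and> (u, v) \<notin> E \<longrightarrow> cliques V (E \<union> {(u, v), (v, u)}) s \<noteq> {})"

lemma card_cliques_le:
  assumes "finite V"
  shows "card (cliques V E m) \<le> 2 ^ card V"
proof -
  have "cliques V E m \<subseteq> Pow V" by (auto simp: cliques_def)
  from card_mono[OF _ this] show ?thesis using assms by (simp add: card_Pow)
qed

lemma card_clique_le_colours:
  assumes "finite C" and "c ` K \<subseteq> C"
    and "\<And>u v. u \<in> K \<Longrightarrow> v \<in> K \<Longrightarrow> u \<noteq> v \<Longrightarrow> c u \<noteq> c v"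
  shows "card K \<le> card C"
  using assms by (meson card_inj_on_le inj_onI)

text \<open>Serves in two directions: an added edge \<open>uv\<close> completes a clique, and in a
  graph free of such cliques \<open>uv\<close> must be absent. \<open>Q\<close> is a clique already
  in \<open>E\<close>, while the edge \<open>uv\<close> is required only in
  \<open>E'\<close>.\<close>

lemma insert_insert_clique:
  assumes "simple_graph V E" and "Q \<in> cliques V E k" and "u \<in> V" and "v \<in> V" and "u \<noteq> v"
    and "\<And>q. q \<in> Q \<Longrightarrow> (u, q) \<in> E \<and> (v, q) \<in> E" and "(u, v) \<in> E'" and "E \<subseteq> E'" and "sym E'"
  shows "insert u (insert v Q) \<in> cliques V E' (k + 2)"
proof -
  have irr: "(x, x) \<notin> E" for x using assms(1) by (auto simp: simple_graph_def irrefl_def)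
  have fin: "finite Q"
    using assms(1,2) by (auto simp: simple_graph_def cliques_def intro: finite_subset)
  have "u \<notin> Q" "v \<notin> Q" using assms(6) irr by blast+
  then have "card (insert u (insert v Q)) = k + 2"
    using fin assms(2,5) by (simp add: cliques_def)
  moreover have "pairwise (\<lambda>x y. (x, y) \<in> E') (insert u (insert v Q))"
    using assms(2,6-9) unfolding cliques_def pairwise_def sym_def by blast
  ultimately show ?thesis using assms(2,3,4) by (auto simp: cliques_def)
qed

text \<open>There are finitely many edge sets inside \<open>V \<times> V\<close>, so an
  inclusion-maximal clique-free one exists; a nonedge that could be added safely would contradict
  maximality.\<close>

lemma ex_clique_saturated_extension:
  assumes "simple_graph V E\<^sub>0" and "cliques V E\<^sub>0 s = {}"
  obtains E where "E\<^sub>0 \<subseteq> E" and "simple_graph V E" and "clique_saturated s V E"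
proof -
  define F where "F = {E. E\<^sub>0 \<subseteq> E \<and> simple_graph V E \<and> cliques V E s = {}}"
  have "F \<subseteq> Pow (V \<times> V)" by (auto simp: F_def simple_graph_def)
  then have "finite F" using assms(1) by (auto simp: simple_graph_def intro: finite_subset)
  moreover have "E\<^sub>0 \<in> F" using assms by (simp add: F_def)
  ultimately obtain E where "E \<in> F" and max: "\<forall>E'\<in>F. E \<subseteq> E' \<longrightarrow> E = E'"
    using finite_has_maximal2 by meson
  then have E: "E\<^sub>0 \<subseteq> E" "simple_graph V E" "cliques V E s = {}" by (auto simp: F_def)
  have "cliques V (E \<union> {(u, v), (v, u)}) s \<noteq> {}"
    if "u \<in> V" "v \<in> V" "u \<noteq> v" "(u, v) \<notin> E" for u v
  proof
    assume "cliques V (E \<union> {(u, v), (v, u)}) s = {}"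
    moreover have "simple_graph V (E \<union> {(u, v), (v, u)})"
      using E that by (auto simp: simple_graph_def sym_def irrefl_def)
    ultimately have "E \<union> {(u, v), (v, u)} \<in> F"
      using E by (auto simp: F_def)
    from max[rule_format, OF this Un_upper1] have "(u, v) \<in> E" by (metis UnI2 insertI1)
    with that show False by simp
  qed
  then show thesis using E that by (auto simp: clique_saturated_def)
qed

section \<open>Copies of complete graphs as cliques\<close>

abbreviation complete_on :: "'a set \<Rightarrow> 'a pair_pre_digraph" where
  "complete_on K \<equiv> \<lparr>pverts = K, parcs = {(u, v). u \<in> K \<and> v \<in> K \<and> u \<noteq> v}\<rparr>"

lemma digraph_iso_complete_graph_iff:
  "digraph_iso (with_proj (complete_graph m)) (with_proj S) \<longleftrightarrow>
    (\<exists>K. finite K \<and> card K = m \<and> S = complete_on K)"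
proof
  assume "digraph_iso (with_proj (complete_graph m)) (with_proj S)"
  then obtain f where f: "pre_digraph.digraph_isomorphism (with_proj (complete_graph m)) f"
    and S: "with_proj S = app_iso f (with_proj (complete_graph m))"
    by (auto simp: digraph_iso_def)
  let ?h = "iso_verts f"
  have inj: "inj_on ?h {..<m}"
    using f by (simp add: pre_digraph.digraph_isomorphism_def complete_graph_def)
  \<comment> \<open>\<open>with_proj\<close> has the projections as tail and head, so the arc map of
    the isomorphism is forced to be the one induced by the vertex map \<open>?h\<close>.\<close>
  have tl: "iso_tail f = fst" "iso_head f = snd"
    using arg_cong[OF S, of tail] arg_cong[OF S, of head] by simp_all
  have arc: "iso_arcs f (u, v) = (?h u, ?h v)" if "u < m" "v < m" "u \<noteq> v" for u v
    using f that unfolding pre_digraph.digraph_isomorphism_def tl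
    by (auto simp: complete_graph_def prod_eq_iff)
  have "pverts S = ?h ` {..<m}"
    using arg_cong[OF S, of verts] by (simp add: complete_graph_def)
  moreover have "parcs S = iso_arcs f ` {(u, v). u < m \<and> v < m \<and> u \<noteq> v}"
    using arg_cong[OF S, of arcs] by (simp add: complete_graph_def)
  moreover have "\<dots> = (\<lambda>(u, v). (?h u, ?h v)) ` {(u, v). u < m \<and> v < m \<and> u \<noteq> v}"
    using arc by (intro image_cong) auto
  moreover have "\<dots> = {(u, v). u \<in> ?h ` {..<m} \<and> v \<in> ?h ` {..<m} \<and> u \<noteq> v}"
    using inj by (auto simp: inj_on_def image_iff)
  ultimately have "S = complete_on (?h ` {..<m})" by simp
  then show "\<exists>K. finite K \<and> card K = m \<and> S = complete_on K"
    using card_image[OF inj] by (intro exI[of _ "?h ` {..<m}"]) auto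
next
  assume "\<exists>K. finite K \<and> card K = m \<and> S = complete_on K"
  then obtain K where K: "finite K" "card K = m" "S = complete_on K" by blast
  then obtain h where h: "bij_betw h {..<m} K"
    by (metis bij_betw_from_nat_into_finite)
  let ?f = "\<lparr>iso_verts = h, iso_arcs = map_prod h h, iso_head = snd, iso_tail = fst\<rparr>"
  have inj: "inj_on h {..<m}" and im: "h ` {..<m} = K"
    using h by (auto simp: bij_betw_def)
  interpret wf_digraph "with_proj (complete_graph m)"
    by unfold_locales (auto simp: complete_graph_def)
  have "inj_on (map_prod h h) {(u, v). u < m \<and> v < m \<and> u \<noteq> v}"
    using inj by (auto simp: inj_on_def)
  then have "digraph_isomorphism ?f"
    using inj unfolding digraph_isomorphism_def
    by (intro conjI wf_digraph_axioms) (auto simp: complete_graph_def)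
  moreover have "with_proj S = app_iso ?f (with_proj (complete_graph m))"
    unfolding with_proj_def app_iso_def complete_graph_def K(3) using im inj
    by (auto simp: inj_on_def image_iff)
  ultimately show "digraph_iso (with_proj (complete_graph m)) (with_proj S)"
    by (auto simp: digraph_iso_def)
qed

text \<open>A complete subgraph is determined by its vertex set, so copies can be counted as sets of
  vertices.\<close>

lemma copies_complete_graph:
  assumes "simple_graph V E"
  shows "copies (complete_graph m) \<lparr>pverts = V, parcs = E\<rparr> = complete_on ` cliques V E m"
proof -
  let ?G = "\<lparr>pverts = V, parcs = E\<rparr>"
  have wf: "wf_digraph (with_proj ?G)"
    using assms by unfold_locales (auto simp: simple_graph_def)
  have wfK: "wf_digraph (with_proj (complete_on K))" for K :: "'a set"
    by unfold_locales auto
  have "subgraph (with_proj (complete_on K)) (with_proj ?G) \<longleftrightarrow>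
      K \<subseteq> V \<and> pairwise (\<lambda>u v. (u, v) \<in> E) K" for K
    using wf wfK by (auto simp: subgraph_def compatible_def pairwise_def)
  moreover have "finite K" if "K \<subseteq> V" for K
    using that assms by (auto simp: simple_graph_def intro: finite_subset)
  ultimately show ?thesis
    unfolding copies_def digraph_iso_complete_graph_iff cliques_def by blast
qed

lemma card_copies_complete_graph:
  assumes "simple_graph V E"
  shows "card (copies (complete_graph m) \<lparr>pverts = V, parcs = E\<rparr>) = card (cliques V E m)"
  unfolding copies_complete_graph[OF assms] by (rule card_image) (auto simp: inj_on_def)

lemma saturated_complete_graph_iff:
  assumes "simple_graph V E"
  shows "saturated (complete_graph s) \<lparr>pverts = V, parcs = E\<rparr> \<longleftrightarrow> clique_saturated s V E"
proof -
  have "simple_graph V (E \<union> {(u, v), (v, u)})" if "u \<in> V" "v \<in> V" "u \<noteq> v" for u v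
    using assms that by (auto simp: simple_graph_def sym_def irrefl_def)
  then show ?thesis
    by (auto simp: saturated_def clique_saturated_def add_edge_def copies_complete_graph assms)
qed

lemma pair_graph_simple_graph:
  assumes "simple_graph V E"
  shows "pair_graph \<lparr>pverts = V, parcs = E\<rparr>"
proof -
  have "finite E" using assms by (auto simp: simple_graph_def intro: finite_subset)
  then show ?thesis
    using assms by unfold_locales (auto simp: simple_graph_def symmetric_def irrefl_def)
qed

section \<open>Degrees, and renaming of vertices by natural numbers\<close>

lemma out_degree_pair_graph:
  "out_degree (with_proj \<lparr>pverts = V, parcs = E\<rparr>) v = card (E `` {v})"
proof -
  have "out_arcs (with_proj \<lparr>pverts = V, parcs = E\<rparr>) v = Pair v ` (E `` {v})"
    by (auto simp: out_arcs_def)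
  moreover have "inj_on (Pair v) (E `` {v})" by (auto simp: inj_on_def)
  ultimately show ?thesis by (simp add: out_degree_def card_image)
qed

lemma min_degree_eqI:
  assumes "simple_graph V E" and "w \<in> V" and "card (E `` {w}) = t"
    and "\<And>v. v \<in> V \<Longrightarrow> t \<le> card (E `` {v})"
  shows "min_degree \<lparr>pverts = V, parcs = E\<rparr> = t"
  unfolding min_degree_def
proof (rule Min_eqI)
  show "finite (out_degree (with_proj \<lparr>pverts = V, parcs = E\<rparr>) ` pverts \<lparr>pverts = V, parcs = E\<rparr>)"
    using assms(1) by (simp add: simple_graph_def)
qed (use assms in \<open>auto simp: out_degree_pair_graph\<close>)

text \<open>\<open>sat_graphs\<close> admits only natural numbers as vertices, whereas the main
  construction uses a datatype. An injection on \<open>V\<close> carries over cliques, saturation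
  and degrees.\<close>

lemma ex_nat_pair_graph:
  fixes V :: "'a set"
  assumes "simple_graph V E" and "clique_saturated s V E" and "w \<in> V" and "card (E `` {w}) = t"
    and "\<And>v. v \<in> V \<Longrightarrow> t \<le> card (E `` {v})"
  shows "\<exists>G :: nat pair_pre_digraph. pair_graph G \<and> card (pverts G) = card V \<and>
    saturated (complete_graph s) G \<and> min_degree G = t \<and>
    card (copies (complete_graph r) G) = card (cliques V E r)"
proof -
  have "finite V" using assms(1) by (simp add: simple_graph_def)
  then obtain h :: "'a \<Rightarrow> nat" where h: "inj_on h V"
    using finite_imp_inj_to_nat_seg[of V] by metis
  let ?V = "h ` V" and ?E = "map_prod h h ` E"
  have EV: "E \<subseteq> V \<times> V" and symE: "sym E" and irr: "irrefl E"
    using assms(1) by (auto simp: simple_graph_def)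
  have E_iff: "(h u, h v) \<in> map_prod h h ` F \<longleftrightarrow> (u, v) \<in> F"
    if "F \<subseteq> V \<times> V" "u \<in> V" "v \<in> V" for F u v
  proof
    assume "(h u, h v) \<in> map_prod h h ` F"
    then obtain a b where "(a, b) \<in> F" "h a = h u" "h b = h v" by auto
    moreover have "a \<in> V" "b \<in> V" using calculation(1) that(1) by auto
    ultimately show "(u, v) \<in> F" using h that by (metis inj_onD)
  qed force
  \<comment> \<open>Stated for an arbitrary edge set \<open>F\<close>, since saturation needs it
    also for \<open>E\<close> enlarged by one edge.\<close>
  have cliques: "cliques ?V (map_prod h h ` F) m = (`) h ` cliques V F m"
    if F: "F \<subseteq> V \<times> V" for F m
  proof -
    have iff: "h ` K \<in> cliques ?V (map_prod h h ` F) m \<longleftrightarrow> K \<in> cliques V F m"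
      if K: "K \<subseteq> V" for K
    proof -
      have "inj_on h K" using h K by (rule inj_on_subset)
      moreover have "(h u, h v) \<in> map_prod h h ` F \<longleftrightarrow> (u, v) \<in> F" if "u \<in> K" "v \<in> K" for u v
        using that by (intro E_iff F subsetD[OF K])
      ultimately show ?thesis
        using K image_mono[OF K, of h]
        by (simp add: cliques_def pairwise_def card_image inj_on_eq_iff)
    qed
    show ?thesis
    proof (intro equalityI subsetI)
      fix L assume L: "L \<in> cliques ?V (map_prod h h ` F) m"
      then obtain K where "K \<subseteq> V" "L = h ` K"
        by (auto simp: cliques_def subset_image_iff)
      with L iff show "L \<in> (`) h ` cliques V F m" by blast
    next
      fix L assume "L \<in> (`) h ` cliques V F m"
      then obtain K where K: "K \<in> cliques V F m" and L: "L = h ` K" by blast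
      then have "K \<subseteq> V" by (simp add: cliques_def)
      with K L iff show "L \<in> cliques ?V (map_prod h h ` F) m" by simp
    qed
  qed
  have simple: "simple_graph ?V ?E"
    unfolding simple_graph_def
  proof (intro conjI)
    show "finite ?V" using \<open>finite V\<close> by simp
    show "?E \<subseteq> ?V \<times> ?V" using EV by auto
    show "sym ?E" using symE by (force simp: sym_def)
    show "irrefl ?E"
    proof (rule irreflI, rule notI)
      fix x assume "(x, x) \<in> ?E"
      then obtain a b where "(a, b) \<in> E" "h a = h b" by auto
      moreover have "a = b" using calculation EV h by (auto dest: inj_onD)
      ultimately show False using irr by (auto simp: irrefl_def)
    qed
  qed
  have "clique_saturated s ?V ?E"
    unfolding clique_saturated_def
  proof (intro conjI ballI impI; (elim imageE)?)
    show "cliques ?V ?E s = {}" using assms(2) cliques[OF EV] by (simp add: clique_saturated_def)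
  next
    fix x y u v assume *: "x \<noteq> y \<and> (x, y) \<notin> ?E" "x = h u" "u \<in> V" "y = h v" "v \<in> V"
    then have "u \<noteq> v" "(u, v) \<notin> E" using E_iff[OF EV] by auto
    then have ne: "cliques V (E \<union> {(u, v), (v, u)}) s \<noteq> {}"
      using assms(2) * by (auto simp: clique_saturated_def)
    have "?E \<union> {(x, y), (y, x)} = map_prod h h ` (E \<union> {(u, v), (v, u)})"
      using * by auto
    then show "cliques ?V (?E \<union> {(x, y), (y, x)}) s \<noteq> {}"
      using ne cliques[of "E \<union> {(u, v), (v, u)}" s] EV * by simp
  qed
  moreover have deg: "card (?E `` {h v}) = card (E `` {v})" if "v \<in> V" for v
  proof -
    have "?E `` {h v} = h ` (E `` {v})"
    proof (intro equalityI subsetI)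
      fix y assume "y \<in> ?E `` {h v}"
      then obtain a b where "(a, b) \<in> E" "h a = h v" "y = h b" by auto
      moreover have "a = v" using calculation EV h that by (auto dest: inj_onD)
      ultimately show "y \<in> h ` (E `` {v})" by auto
    qed force
    moreover have "inj_on h (E `` {v})" using h EV by (auto intro: inj_on_subset)
    ultimately show ?thesis by (simp add: card_image)
  qed
  moreover have "card (cliques ?V ?E r) = card (cliques V E r)"
    unfolding cliques[OF EV] using h
    by (intro card_image inj_onI) (auto simp: cliques_def inj_on_image_eq_iff)
  moreover have "card ?V = card V" using h by (rule card_image)
  moreover have "min_degree \<lparr>pverts = ?V, parcs = ?E\<rparr> = t"
    by (rule min_degree_eqI[OF simple, of "h w"]) (use assms(3-5) deg in auto)
  ultimately show ?thesis
    using simple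
    by (intro exI[of _ "\<lparr>pverts = ?V, parcs = ?E\<rparr>"])
      (simp add: pair_graph_simple_graph saturated_complete_graph_iff card_copies_complete_graph)
qed

section \<open>The complete multipartite graph for small \<open>n\<close>\<close>

text \<open>The parts are the residue classes modulo \<open>k\<close> of the numbers below
  \<open>t\<close>, nonempty as \<open>k \<le> t\<close>, and the block from \<open>t\<close> up to
  \<open>n\<close>. A vertex of the block has exactly \<open>t\<close> neighbours; a vertex below
  \<open>t\<close> sees the whole block, of size \<open>n - t \<ge> t\<close>.\<close>

lemma complete_multipartite_saturated:
  fixes k t n :: nat
  assumes "1 \<le> k" and "k \<le> t" and "2 * t \<le> n"
  obtains E where "simple_graph {..<n} E" and "clique_saturated (k + 2) {..<n} E"
    and "card (E `` {t}) = t" and "\<And>v. v < n \<Longrightarrow> t \<le> card (E `` {v})"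
proof
  define c where "c x = (if x < t then x mod k else k)" for x
  let ?E = "{(u, v). u < n \<and> v < n \<and> c u \<noteq> c v}"
  have mod_less: "x mod k < k" for x using assms(1) by simp
  have c_le: "c x \<le> k" for x using less_imp_le[OF mod_less[of x]] by (simp add: c_def)
  have c_k: "c x = k \<longleftrightarrow> t \<le> x" for x using less_imp_neq[OF mod_less[of x]] by (simp add: c_def)
  define rep where "rep j = (if j < k then j else t)" for j
  have rep: "c (rep j) = j" "rep j < n" if "j \<le> k" for j
  proof -
    show "rep j < n" using that assms by (simp add: rep_def)
    show "c (rep j) = j"
    proof (cases "j < k")
      case True
      then have "j < t" using assms(2) by simp
      then show ?thesis using True by (simp add: c_def rep_def)
    qed (use that in \<open>simp add: c_def rep_def\<close>)
  qed
  show simple: "simple_graph {..<n} ?E" by (auto simp: simple_graph_def sym_def irrefl_def)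
  have "card K \<noteq> k + 2" if "pairwise (\<lambda>u v. (u, v) \<in> ?E) K" for K
  proof -
    have "card K \<le> card {..k}"
      by (rule card_clique_le_colours[where c = c]) (use that c_le in \<open>auto simp: pairwise_def\<close>)
    then show ?thesis by simp
  qed
  then have free: "cliques {..<n} ?E (k + 2) = {}" by (auto simp: cliques_def)
  have "cliques {..<n} (?E \<union> {(u, v), (v, u)}) (k + 2) \<noteq> {}"
    if "u < n" "v < n" "u \<noteq> v" "(u, v) \<notin> ?E" for u v
  proof -
    have cuv: "c v = c u" using that by simp
    \<comment> \<open>One representative of each part other than the common part of \<open>u\<close>
      and \<open>v\<close> gives a \<open>k\<close>-clique that both see.\<close>
    let ?Q = "rep ` ({..k} - {c u})"
    have inj: "inj_on rep ({..k} - {c u})" by (rule inj_on_inverseI[of _ c]) (simp add: rep)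
    have "card ?Q = k" using c_le[of u] by (simp add: card_image[OF inj])
    moreover have "pairwise (\<lambda>x y. (x, y) \<in> ?E) ?Q" by (auto simp: pairwise_def rep)
    ultimately have Q: "?Q \<in> cliques {..<n} ?E k" by (auto simp: cliques_def rep)
    have "insert u (insert v ?Q) \<in> cliques {..<n} (?E \<union> {(u, v), (v, u)}) (k + 2)"
      by (rule insert_insert_clique[OF simple Q]) (use that cuv in \<open>auto simp: rep sym_def\<close>)
    then show ?thesis by blast
  qed
  with free show "clique_saturated (k + 2) {..<n} ?E"
    unfolding clique_saturated_def by blast
  have ct: "c t = k" and tn: "t < n" using assms by (simp_all add: c_def)
  have "?E `` {t} = {..<t}"
  proof (rule set_eqI)
    fix x
    have "c t \<noteq> c x \<longleftrightarrow> x < t" unfolding ct using c_k[of x] by (metis not_less)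
    then show "x \<in> ?E `` {t} \<longleftrightarrow> x \<in> {..<t}" using tn by simp (metis less_trans)
  qed
  then show "card (?E `` {t}) = t" by simp
  show "t \<le> card (?E `` {v})" if "v < n" for v
  proof -
    have fin: "finite (?E `` {v})" by (rule finite_subset[of _ "{..<n}"]) auto
    show ?thesis
    proof (cases "t \<le> v")
      case True
      then have "c v = k" using c_k by simp
      moreover have "c x \<noteq> k" if "x < t" for x using that c_k[of x] by simp
      ultimately have "{..<t} \<subseteq> ?E `` {v}"
        using \<open>v < n\<close> tn by (simp add: subset_iff) (metis less_trans)
      from card_mono[OF fin this] show ?thesis by simp
    next
      case False
      then have "c v \<noteq> k" using c_k by simp
      moreover have "c x = k" if "t \<le> x" for x using that c_k[of x] by simp
      ultimately have "{t..<n} \<subseteq> ?E `` {v}" using \<open>v < n\<close> by (simp add: subset_iff)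
      from card_mono[OF fin this] show ?thesis using assms(3) by simp
    qed
  qed
qed

section \<open>The core, bulk and witness graph\<close>

text \<open>
  \<open>Bulk\<close> are the \<open>m\<close> vertices whose number grows with \<open>n\<close>; \<open>Ext\<close> raises their degree from \<open>2 * k\<close> to \<open>t\<close>.
  For each core vertex \<open>Core i e\<close> and each \<open>c\<close>, the vertices \<open>Wit i e j c\<close> with \<open>j < k\<close> form a \<open>k\<close>-clique in the
  neighbourhood of \<open>Core i e\<close>, so that \<open>Core i e\<close> cannot be joined to any \<open>Ext y\<close>. The last index \<open>c\<close>
  only serves to make the degrees at least \<open>t\<close>. The core neighbours of \<open>Wit i e j c\<close> form a transversal
  \<open>k\<close>-clique, so that \<open>Wit i e j c\<close> cannot be joined to any \<open>Bulk v\<close>.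
\<close>

datatype vertex = Core nat bool | Bulk nat | Ext nat | Wit nat bool nat nat

text \<open>Each kind of pair is listed in one order and symmetrised in \<open>E\<^sub>0\<close>.
  The transversal seen by \<open>Wit i e j c\<close> takes side \<open>e\<close> in layer
  \<open>i\<close>, and elsewhere side \<open>True\<close> in layer \<open>j\<close> alone. Hence a
  core vertex outside layer \<open>i\<close> that sees witnesses of one family with different
  indices \<open>j\<close> and \<open>j'\<close> lies in neither of these two layers, which keeps
  the graph clique-free.\<close>

fun half_adj :: "vertex \<Rightarrow> vertex \<Rightarrow> bool" where
  "half_adj (Core i b) (Core j b') \<longleftrightarrow> i \<noteq> j"
| "half_adj (Core _ _) (Bulk _) \<longleftrightarrow> True"
| "half_adj (Bulk _) (Ext _) \<longleftrightarrow> True"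
| "half_adj (Ext _) (Wit _ _ _ _) \<longleftrightarrow> True"
| "half_adj (Core i' b) (Wit i e j c) \<longleftrightarrow> b = (if i' = i then e else i' = j)"
| "half_adj (Wit i e j c) (Wit i' e' j' c') \<longleftrightarrow> i = i' \<and> e = e' \<and> j \<noteq> j'"
| "half_adj _ _ \<longleftrightarrow> False"

text \<open>\<open>t \<le> m\<close> lets core and \<open>Ext\<close> vertices reach degree
  \<open>t\<close> through \<open>Bulk\<close> alone; \<open>2 \<le> k\<close> provides each witness
  with a second index \<open>j\<close>.\<close>

locale core_bulk_graph =
  fixes k t p m :: nat
  assumes k_ge_2: "2 \<le> k" and t_eq: "t = 2 * k + p" and m_ge_t: "t \<le> m"
begin

definition cores :: "vertex set" where "cores = (\<lambda>(i, b). Core i b) ` ({..<k} \<times> UNIV)"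
definition wits :: "vertex set" where
  "wits = (\<lambda>(i, e, j, c). Wit i e j c) ` ({..<k} \<times> UNIV \<times> {..<k} \<times> {..<t})"
definition rest :: "vertex set" where "rest = cores \<union> Ext ` {..<p} \<union> wits"
definition V :: "vertex set" where "V = rest \<union> Bulk ` {..<m}"
definition E\<^sub>0 :: "vertex rel" where
  "E\<^sub>0 = {(u, v). u \<in> V \<and> v \<in> V \<and> (half_adj u v \<or> half_adj v u)}"

lemma t_pos: "0 < t" using k_ge_2 t_eq by simp

lemma in_V [simp]:
  "Core i b \<in> V \<longleftrightarrow> i < k" "Bulk v \<in> V \<longleftrightarrow> v < m" "Ext y \<in> V \<longleftrightarrow> y < p"
  "Wit i e j c \<in> V \<longleftrightarrow> i < k \<and> j < k \<and> c < t"
  by (auto simp: V_def rest_def cores_def wits_def)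
    (rule image_eqI[where x = "(i, e, j, c)"], simp_all)

lemma card_cores: "finite cores" "card cores = 2 * k"
  unfolding cores_def
  by (simp, subst card_image) (auto simp: inj_on_def card_cartesian_product)

lemma card_rest: "finite rest" "card rest = t + 2 * k * k * t"
proof -
  have wits: "finite wits" "card wits = 2 * k * k * t"
    unfolding wits_def
    by (simp, subst card_image) (auto simp: inj_on_def card_cartesian_product)
  show "finite rest" unfolding rest_def using wits card_cores by simp
  have "card (cores \<union> Ext ` {..<p} \<union> wits) = card (cores \<union> Ext ` {..<p}) + card wits"
    by (rule card_Un_disjoint) (use wits card_cores in \<open>auto simp: cores_def wits_def\<close>)
  also have "card (cores \<union> Ext ` {..<p}) = card cores + card (Ext ` {..<p})"
    by (rule card_Un_disjoint) (use card_cores in \<open>auto simp: cores_def\<close>)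
  also have "card (Ext ` {..<p}) = p" by (simp add: card_image inj_on_def)
  finally show "card rest = t + 2 * k * k * t"
    unfolding rest_def using wits card_cores t_eq by linarith
qed

lemma card_V: "finite V" "card V = t + 2 * k * k * t + m"
proof -
  show "finite V" unfolding V_def using card_rest by simp
  have "card (rest \<union> Bulk ` {..<m}) = card rest + card (Bulk ` {..<m})"
    by (rule card_Un_disjoint) (use card_rest in \<open>auto simp: rest_def cores_def wits_def\<close>)
  also have "card (Bulk ` {..<m}) = m" by (simp add: card_image inj_on_def)
  finally show "card V = t + 2 * k * k * t + m" using card_rest by (simp add: V_def)
qed

lemma half_adj_irrefl: "\<not> half_adj u u"
  by (cases u) auto

lemma simple_graph_E\<^sub>0: "simple_graph V E\<^sub>0"
  using card_V half_adj_irrefl by (auto simp: simple_graph_def E\<^sub>0_def sym_def irrefl_def)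

lemma E\<^sub>0_iff: "(u, v) \<in> E\<^sub>0 \<longleftrightarrow> u \<in> V \<and> v \<in> V \<and> (half_adj u v \<or> half_adj v u)"
  by (simp add: E\<^sub>0_def)

section \<open>Clique-freeness of the starting graph\<close>

text \<open>A supposed clique \<open>K\<close> is properly coloured with the \<open>k + 1\<close>
  colours up to \<open>k\<close>, which is too few. The colouring depends on the kinds of vertices
  that \<open>K\<close> contains.\<close>

lemma clique_free_E\<^sub>0: "cliques V E\<^sub>0 (k + 2) = {}"
proof (rule equals0I)
  fix K assume "K \<in> cliques V E\<^sub>0 (k + 2)"
  then have KV: "K \<subseteq> V" and card: "card K = k + 2"
    and adj: "\<And>u v. u \<in> K \<Longrightarrow> v \<in> K \<Longrightarrow> u \<noteq> v \<Longrightarrow> half_adj u v \<or> half_adj v u"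
    by (auto simp: cliques_def pairwise_def E\<^sub>0_iff)
  have no_colouring: False
    if "\<And>u. u \<in> K \<Longrightarrow> c u \<le> k"
      and "\<And>u v. u \<in> K \<Longrightarrow> v \<in> K \<Longrightarrow> u \<noteq> v \<Longrightarrow> half_adj u v \<Longrightarrow> c u \<noteq> c v" for c
  proof -
    have "card K \<le> card {..k}"
    proof (rule card_clique_le_colours)
      show "c ` K \<subseteq> {..k}" using that(1) by auto
      show "c u \<noteq> c v" if "u \<in> K" "v \<in> K" "u \<noteq> v" for u v
        using adj[OF that] \<open>\<And>u v. \<lbrakk>u \<in> K; v \<in> K; u \<noteq> v; half_adj u v\<rbrakk> \<Longrightarrow> c u \<noteq> c v\<close> that
        by metis
    qed simp
    then show False using card by simp
  qed
  have in_K: "Core i b \<in> K \<Longrightarrow> i < k" "Wit i e j c \<in> K \<Longrightarrow> j < k" for i b e j c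
    using KV by (auto dest: subsetD)
  consider (no_core) "\<And>i b. Core i b \<notin> K"
    | (no_wit) i b where "Core i b \<in> K" "\<And>i e j c. Wit i e j c \<notin> K"
    | (core_wit) i' b i e j c where "Core i' b \<in> K" "Wit i e j c \<in> K"
    by metis
  then show False
  proof cases
    case no_core
    \<comment> \<open>Without core vertices, \<open>Bulk\<close> sees nothing but \<open>Ext\<close>
      in \<open>K\<close>, so it can share the colour 0 with witnesses.\<close>
    show False
    proof (rule no_colouring[where c = "\<lambda>u. case u of Ext _ \<Rightarrow> k | Wit _ _ j _ \<Rightarrow> j | _ \<Rightarrow> 0"])
      fix u v assume "u \<in> K" "v \<in> K" "half_adj u v"
      then show "(case u of Ext _ \<Rightarrow> k | Wit _ _ j _ \<Rightarrow> j | _ \<Rightarrow> 0) \<noteq>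
          (case v of Ext _ \<Rightarrow> k | Wit _ _ j _ \<Rightarrow> j | _ \<Rightarrow> 0)"
        using no_core k_ge_2 in_K by (cases u; cases v) (auto dest: in_K(2))
    qed (use in_K in \<open>auto split: vertex.split dest: in_K(2)\<close>)
  next
    case no_wit
    have no_ext: "Ext y \<notin> K" for y using adj[OF no_wit(1), of "Ext y"] by auto
    \<comment> \<open>A core vertex excludes every \<open>Ext\<close> vertex, so colour
      \<open>k\<close> goes only to \<open>Bulk\<close> vertices, which are pairwise
      nonadjacent.\<close>
    show False
    proof (rule no_colouring[where c = "\<lambda>u. case u of Core i _ \<Rightarrow> i | _ \<Rightarrow> k"])
      fix u v assume "u \<in> K" "v \<in> K" "half_adj u v"
      then show "(case u of Core i _ \<Rightarrow> i | _ \<Rightarrow> k) \<noteq> (case v of Core i _ \<Rightarrow> i | _ \<Rightarrow> k)"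
        using no_wit no_ext by (cases u; cases v) (auto dest: in_K(1))
    qed (auto split: vertex.split dest: in_K(1))
  next
    case core_wit
    have no_ext: "Ext y \<notin> K" for y using adj[OF core_wit(1), of "Ext y"] by auto
    have no_bulk: "Bulk v \<notin> K" for v using adj[OF core_wit(2), of "Bulk v"] by auto
    have same: "i2 = i" "e2 = e" if "Wit i2 e2 j2 c2 \<in> K" for i2 e2 j2 c2
      using adj[OF core_wit(2) that] by auto
    show False
    proof (cases "\<exists>j2 c2. Wit i e j2 c2 \<in> K \<and> j2 \<noteq> j")
      case False
      \<comment> \<open>Witnesses with equal \<open>j\<close> are nonadjacent, so \<open>K\<close>
        has a single witness, which can take colour \<open>k\<close>.\<close>
      have one: "j2 = j" "c2 = c" if "Wit i2 e2 j2 c2 \<in> K" for i2 e2 j2 c2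
        using adj[OF core_wit(2) that] same[OF that] that False by auto
      show False
      proof (rule no_colouring[where c = "\<lambda>u. case u of Core i _ \<Rightarrow> i | _ \<Rightarrow> k"])
        fix u v assume "u \<in> K" "v \<in> K" "u \<noteq> v" "half_adj u v"
        then show "(case u of Core i _ \<Rightarrow> i | _ \<Rightarrow> k) \<noteq> (case v of Core i _ \<Rightarrow> i | _ \<Rightarrow> k)"
          using no_ext no_bulk by (cases u; cases v) (auto dest: in_K(1) one(1))
      qed (auto split: vertex.split dest: in_K(1))
    next
      case True
      then obtain j' c' where j': "Wit i e j' c' \<in> K" "j' \<noteq> j" by blast
      have core_val: "b2 = (if i2 = i then e else i2 = j2)"
        if "Core i2 b2 \<in> K" "Wit i e j2 c2 \<in> K" for i2 b2 j2 c2
        using adj[OF that, simplified] .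
      \<comment> \<open>Several witnesses keep their indices as colours, and layer \<open>i\<close>,
        where all of them see the same core vertex, moves to the spare colour
        \<open>k\<close>.\<close>
      let ?c = "\<lambda>u. case u of Core i2 _ \<Rightarrow> (if i2 = i then k else i2) | Wit _ _ j2 _ \<Rightarrow> j2 | _ \<Rightarrow> 0"
      \<comment> \<open>A core vertex outside layer \<open>i\<close> sharing its index with a
        witness would be on side \<open>True\<close>; every witness in \<open>K\<close> would then
        have that same index, contrary to \<open>j' \<noteq> j\<close>.\<close>
      have core_not_wit: "i2 \<noteq> j2" if "Core i2 b2 \<in> K" "Wit i e j2 c2 \<in> K" "i2 \<noteq> i" for i2 b2 j2 c2
      proof
        assume "i2 = j2"
        with that have "i2 = j" "i2 = j'"
          using core_val[OF that(1,2)] core_val[OF that(1) core_wit(2)]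
            core_val[OF that(1) j'(1)] by simp_all
        with j'(2) show False by simp
      qed
      show False
      proof (rule no_colouring[where c = ?c])
        fix u v assume uv: "u \<in> K" "v \<in> K" "u \<noteq> v" "half_adj u v"
        show "?c u \<noteq> ?c v"
        proof (cases u)
          case u: (Core i1 b1)
          show ?thesis
          proof (cases v)
            case (Core i2 b2)
            then show ?thesis using u uv in_K(1)[of i1 b1] in_K(1)[of i2 b2] by simp
          next
            case (Wit i2 e2 j2 c2)
            then have "Wit i e j2 c2 \<in> K" "j2 < k"
              using uv(2) same[of i2 e2 j2 c2] in_K(2)[of i2 e2 j2 c2] by simp_all
            then show ?thesis using u Wit uv(1) core_not_wit[of i1 b1 j2 c2] by simp
          qed (use uv no_ext no_bulk in auto)
        next
          case u: (Wit i1 e1 j1 c1)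
          with uv show ?thesis by (cases v) auto
        qed (use uv no_ext no_bulk in auto)
      next
        fix u assume "u \<in> K"
        then show "?c u \<le> k" by (cases u) (auto dest!: in_K)
      qed
    qed
  qed
qed

section \<open>Cliques in the core and among the witnesses\<close>

lemma core_transversal: "(\<lambda>i. Core i (f i)) ` {..<k} \<in> cliques V E\<^sub>0 k"
  by (auto simp: cliques_def pairwise_def E\<^sub>0_iff card_image inj_on_def)

lemma wit_clique: "i < k \<Longrightarrow> (\<lambda>j. Wit i e j 0) ` {..<k} \<in> cliques V E\<^sub>0 k"
  using t_pos by (auto simp: cliques_def pairwise_def E\<^sub>0_iff card_image inj_on_def)

text \<open>Choose the \<open>q\<close> layers, then one side in each.\<close>

lemma card_transversals_le:
  "card {S. S \<subseteq> cores \<and> card S = q \<and> (\<forall>i. \<not> (Core i True \<in> S \<and> Core i False \<in> S))}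
    \<le> (k choose q) * 2 ^ q" (is "card ?T \<le> _")
proof -
  define coord where "coord u = (case u of Core i _ \<Rightarrow> i | _ \<Rightarrow> 0)" for u
  \<comment> \<open>A set is coded by its layers and by those layers where side \<open>True\<close>
    is taken; this is injective as no layer is used twice. The default branch of
    \<open>coord\<close> is never reached on subsets of \<open>cores\<close>.\<close>
  let ?f = "\<lambda>S. (coord ` S, {i. Core i True \<in> S})"
  let ?R = "SIGMA J:{J. J \<subseteq> {..<k} \<and> card J = q}. Pow J"
  have core: "\<exists>i b. u = Core i b \<and> i < k" if "S \<in> ?T" "u \<in> S" for S u
    using that by (auto simp: cores_def)
  have fin: "finite J" if "J \<subseteq> {..<k}" for J using that by (rule finite_subset) simp
  have "?f S \<in> ?R" if S: "S \<in> ?T" for S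
  proof -
    have "inj_on coord S"
    proof (rule inj_onI)
      fix u v assume uv: "u \<in> S" "v \<in> S" "coord u = coord v"
      from core[OF S uv(1)] core[OF S uv(2)] obtain i b i' b'
        where "u = Core i b" "v = Core i' b'" by blast
      with uv S show "u = v" by (cases b; cases b') (auto simp: coord_def)
    qed
    then have "card (coord ` S) = q" using S by (simp add: card_image)
    moreover have "coord ` S \<subseteq> {..<k}" using core[OF S] by (fastforce simp: coord_def)
    moreover have "{i. Core i True \<in> S} \<subseteq> coord ` S" by (force simp: coord_def)
    ultimately show ?thesis by simp
  qed
  then have range: "?f ` ?T \<subseteq> ?R" by blast
  have inj: "inj_on ?f ?T"
  proof (rule inj_onI)
    fix S S' assume S: "S \<in> ?T" "S' \<in> ?T" and eq: "?f S = ?f S'"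
    have sub: "A \<subseteq> B" if A: "A \<in> ?T" and B: "B \<in> ?T" and AB: "?f A = ?f B" for A B
    proof
      fix u assume u: "u \<in> A"
      obtain i b where ib: "u = Core i b" using core[OF A u] by blast
      have "i \<in> coord ` A" using u ib by (force simp: coord_def)
      also have "coord ` A = coord ` B" using AB by simp
      finally obtain u' where u': "u' \<in> B" "coord u' = i" by blast
      with core[OF B] obtain b' where b': "Core i b' \<in> B" by (fastforce simp: coord_def)
      have "{i. Core i True \<in> A} = {i. Core i True \<in> B}" using AB by simp
      then have "Core i True \<in> A \<longleftrightarrow> Core i True \<in> B" by blast
      with u ib b' A show "u \<in> B" by (cases b; cases b') auto
    qed
    from sub[OF S eq] sub[OF S(2,1) eq[symmetric]] show "S = S'" by (rule equalityI)
  qed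
  have "finite ?R" using fin by (intro finite_SigmaI) auto
  with inj range have "card ?T \<le> card ?R" by (rule card_inj_on_le)
  also have "card ?R = (\<Sum>J | J \<subseteq> {..<k} \<and> card J = q. card (Pow J))"
    using fin by (intro card_SigmaI) auto
  also have "\<dots> = (\<Sum>J | J \<subseteq> {..<k} \<and> card J = q. 2 ^ q)"
    using fin by (intro sum.cong) (auto simp: card_Pow)
  also have "\<dots> = (k choose q) * 2 ^ q" using n_subsets[of "{..<k}" q] by simp
  finally show ?thesis .
qed

section \<open>Nonedges forced in every clique-free extension\<close>

context
  fixes E
  assumes E_ge: "E\<^sub>0 \<subseteq> E" and simple_E: "simple_graph V E" and free_E: "cliques V E (k + 2) = {}"
begin

lemma non_adjacentI:
  assumes "Q \<in> cliques V E\<^sub>0 k" and "u \<in> V" and "v \<in> V" and "u \<noteq> v"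
    and "\<And>q. q \<in> Q \<Longrightarrow> (u, q) \<in> E\<^sub>0 \<and> (v, q) \<in> E\<^sub>0"
  shows "(u, v) \<notin> E"
proof
  assume "(u, v) \<in> E"
  moreover have "sym E" using simple_E by (simp add: simple_graph_def)
  ultimately have "insert u (insert v Q) \<in> cliques V E (k + 2)"
    using insert_insert_clique[OF simple_graph_E\<^sub>0] assms E_ge by blast
  with free_E show False by simp
qed

lemma E_in_V: "(u, v) \<in> E \<Longrightarrow> u \<in> V \<and> v \<in> V \<and> u \<noteq> v"
  using simple_E by (auto simp: simple_graph_def irrefl_def)

lemma bulk_bulk: "(Bulk v, Bulk w) \<notin> E"
proof
  assume *: "(Bulk v, Bulk w) \<in> E"
  have "(Bulk v, Bulk w) \<notin> E"
    by (rule non_adjacentI[OF core_transversal[of "\<lambda>_. False"]])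
      (use E_in_V[OF *] in \<open>auto simp: E\<^sub>0_iff\<close>)
  with * show False by simp
qed

lemma bulk_wit: "(Bulk v, Wit i e j c) \<notin> E"
proof
  assume *: "(Bulk v, Wit i e j c) \<in> E"
  \<comment> \<open>The transversal chosen is the set of core neighbours of the witness;
    \<open>Bulk v\<close> sees the whole core.\<close>
  have "(Bulk v, Wit i e j c) \<notin> E"
    by (rule non_adjacentI[OF core_transversal[of "\<lambda>i'. if i' = i then e else i' = j"]])
      (use E_in_V[OF *] in \<open>auto simp: E\<^sub>0_iff\<close>)
  with * show False by simp
qed

text \<open>\<open>Core i e\<close> sees every \<open>Wit i e j 0\<close>, whose transversal takes
  side \<open>e\<close> in layer \<open>i\<close>, and \<open>Ext y\<close> sees all
  witnesses.\<close>

lemma core_ext: "(Core i e, Ext y) \<notin> E"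
proof
  assume *: "(Core i e, Ext y) \<in> E"
  have i: "i < k" using E_in_V[OF *] by simp
  have "(Core i e, Ext y) \<notin> E"
    by (rule non_adjacentI[OF wit_clique[OF i, of e]])
      (use E_in_V[OF *] t_pos in \<open>auto simp: E\<^sub>0_iff\<close>)
  with * show False by simp
qed

lemma ext_ext: "(Ext x, Ext y) \<notin> E"
proof
  assume *: "(Ext x, Ext y) \<in> E"
  have k: "0 < k" using k_ge_2 by simp
  have "(Ext x, Ext y) \<notin> E"
    by (rule non_adjacentI[OF wit_clique[OF k, of False]])
      (use E_in_V[OF *] t_pos k in \<open>auto simp: E\<^sub>0_iff\<close>)
  with * show False by simp
qed

lemma core_core: "(Core i True, Core i False) \<notin> E"
proof
  assume *: "(Core i True, Core i False) \<in> E"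
  have i: "i < k" using E_in_V[OF *] by simp
  have m: "0 < m" using t_pos m_ge_t by simp
  \<comment> \<open>Both vertices of layer \<open>i\<close> see a bulk vertex and one vertex from
    each of the other \<open>k - 1\<close> layers.\<close>
  let ?Q = "insert (Bulk 0) ((\<lambda>j. Core j False) ` ({..<k} - {i}))"
  have "card ((\<lambda>j. Core j False) ` ({..<k} - {i})) = k - 1"
    using i by (simp add: card_image inj_on_def)
  then have "card ?Q = k" using k_ge_2 by (subst card_insert_disjoint) auto
  then have Q: "?Q \<in> cliques V E\<^sub>0 k"
    using m by (auto simp: cliques_def pairwise_def E\<^sub>0_iff)
  have "(Core i True, Core i False) \<notin> E"
    by (rule non_adjacentI[OF Q]) (use i m in \<open>auto simp: E\<^sub>0_iff\<close>)
  with * show False by simp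
qed

text \<open>The forced nonedges leave no room for new edges at \<open>Bulk v\<close>, so its degree
  stays \<open>2 * k + p = t\<close>.\<close>

lemma bulk_neighbours: "v < m \<Longrightarrow> E `` {Bulk v} = cores \<union> Ext ` {..<p}"
proof (intro equalityI subsetI)
  fix u assume "u \<in> E `` {Bulk v}"
  then show "u \<in> cores \<union> Ext ` {..<p}"
    using bulk_bulk bulk_wit E_in_V[of "Bulk v" u] by (cases u) (auto simp: cores_def)
next
  fix u assume "v < m" "u \<in> cores \<union> Ext ` {..<p}"
  then have "(Bulk v, u) \<in> E\<^sub>0" by (auto simp: E\<^sub>0_iff cores_def)
  then show "u \<in> E `` {Bulk v}" using E_ge by auto
qed

section \<open>Degrees and clique count in the extension\<close>

lemma degree_bulk: "v < m \<Longrightarrow> card (E `` {Bulk v}) = t"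
proof -
  assume "v < m"
  have "card (cores \<union> Ext ` {..<p}) = card cores + card (Ext ` {..<p})"
    by (rule card_Un_disjoint) (use card_cores in \<open>auto simp: cores_def\<close>)
  also have "card (Ext ` {..<p}) = p" by (simp add: card_image inj_on_def)
  finally show ?thesis using \<open>v < m\<close> card_cores by (simp add: bulk_neighbours t_eq)
qed

lemma degree_ge: "u \<in> V \<Longrightarrow> t \<le> card (E `` {u})"
proof -
  assume u: "u \<in> V"
  have "finite (E `` {u})"
    using simple_E by (auto simp: simple_graph_def intro: finite_subset[of _ V])
  then have ge: "card N \<le> card (E `` {u})" if "N \<subseteq> E\<^sub>0 `` {u}" for N
    using that E_ge by (intro card_mono) auto
  have bulk: "t \<le> card (E `` {u})" if "Bulk ` {..<m} \<subseteq> E\<^sub>0 `` {u}"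
    using ge[OF that] m_ge_t by (simp add: card_image inj_on_def)
  show ?thesis
  proof (cases u)
    case (Bulk v)
    then show ?thesis using u degree_bulk by simp
  next
    case (Wit i e j c)
    \<comment> \<open>An index below \<open>k\<close> other than \<open>j\<close>; the
      \<open>t\<close> values of the last argument then give \<open>t\<close> neighbours.\<close>
    define j' :: nat where "j' = (if j = 0 then 1 else 0)"
    have "Wit i e j' ` {..<t} \<subseteq> E\<^sub>0 `` {u}"
      using u k_ge_2 by (auto simp: Wit E\<^sub>0_iff j'_def)
    from ge[OF this] show ?thesis by (simp add: card_image inj_on_def)
  next
    case (Core i b)
    show ?thesis by (rule bulk) (use u Core in \<open>auto simp: E\<^sub>0_iff\<close>)
  next
    case (Ext y)
    show ?thesis by (rule bulk) (use u Ext in \<open>auto simp: E\<^sub>0_iff\<close>)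
  qed
qed

text \<open>Cliques avoiding \<open>Bulk\<close> are subsets of \<open>rest\<close>. A clique
  through \<open>Bulk v\<close> has its other \<open>r - 1\<close> vertices in the core, at most one
  per layer, which gives the term linear in \<open>m\<close>.\<close>

lemma card_cliques_E_le:
  assumes "3 \<le> r"
  shows "card (cliques V E r) \<le> 2 ^ card rest + m * ((k choose (r - 1)) * 2 ^ (r - 1))"
proof -
  let ?T = "{S. S \<subseteq> cores \<and> card S = r - 1 \<and> (\<forall>i. \<not> (Core i True \<in> S \<and> Core i False \<in> S))}"
  let ?f = "\<lambda>(v, S). insert (Bulk v) S"
  have finT: "finite ?T" by (rule finite_subset[of _ "Pow cores"]) (use card_cores in auto)
  have "cliques V E r \<subseteq> Pow rest \<union> ?f ` ({..<m} \<times> ?T)"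
  proof
    fix K assume K: "K \<in> cliques V E r"
    then have KV: "K \<subseteq> V" and card: "card K = r"
      and adj: "\<And>u v. u \<in> K \<Longrightarrow> v \<in> K \<Longrightarrow> u \<noteq> v \<Longrightarrow> (u, v) \<in> E"
      by (auto simp: cliques_def pairwise_def)
    have finK: "finite K" using KV card_V(1) by (rule finite_subset)
    show "K \<in> Pow rest \<union> ?f ` ({..<m} \<times> ?T)"
    proof (cases "\<exists>v. Bulk v \<in> K")
      case False
      then show ?thesis using KV by (auto simp: V_def)
    next
      case True
      then obtain v where v: "Bulk v \<in> K" by blast
      then have vm: "v < m" using KV by auto
      let ?S = "K - {Bulk v}"
      have cardS: "card ?S = r - 1" using v finK card by simp
      have S_sub: "?S \<subseteq> cores \<union> Ext ` {..<p}"
        using adj[OF v] bulk_neighbours[OF vm] by auto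
      have no_ext: "Ext y \<notin> ?S" for y
      proof
        assume y: "Ext y \<in> ?S"
        \<comment> \<open>\<open>3 \<le> r\<close> leaves a further vertex of the clique in the
          neighbourhood of \<open>Bulk v\<close>, but within that neighbourhood \<open>Ext y\<close>
          is isolated.\<close>
        have "card (?S - {Ext y}) \<noteq> 0" using y finK cardS assms by simp
        then obtain u where u: "u \<in> ?S" "u \<noteq> Ext y" by (metis card_eq_0_iff ex_in_conv Diff_iff insertI1)
        then have "(u, Ext y) \<in> E" using y adj by blast
        moreover have "u \<in> cores \<union> Ext ` {..<p}" using u S_sub by blast
        ultimately show False using core_ext ext_ext by (auto simp: cores_def)
      qed
      then have "?S \<subseteq> cores" using S_sub by blast
      moreover have "\<not> (Core i True \<in> ?S \<and> Core i False \<in> ?S)" for i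
        using adj[of "Core i True" "Core i False"] core_core by auto
      ultimately have "?S \<in> ?T" using cardS by blast
      moreover have "K = ?f (v, ?S)" using v by auto
      ultimately show ?thesis using vm by blast
    qed
  qed
  then have "card (cliques V E r) \<le> card (Pow rest \<union> ?f ` ({..<m} \<times> ?T))"
    using card_rest finT by (intro card_mono) auto
  also have "\<dots> \<le> card (Pow rest) + card (?f ` ({..<m} \<times> ?T))" by (rule card_Un_le)
  also have "card (?f ` ({..<m} \<times> ?T)) \<le> card ({..<m} \<times> ?T)"
    using finT by (intro card_image_le) simp
  also have "card ({..<m} \<times> ?T) = m * card ?T" by (simp add: card_cartesian_product)
  also have "m * card ?T \<le> m * ((k choose (r - 1)) * 2 ^ (r - 1))"
    by (intro mult_left_mono card_transversals_le) simp
  finally show ?thesis using card_rest by (simp add: card_Pow)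
qed

end

end

section \<open>Assembly of the two constructions\<close>

theorem theorem3:
  fixes r s t :: nat
  assumes "r \<ge> 3" and "s > r" and "t \<ge> 2 * (s - 2) + 1"
  shows "\<exists>C :: nat. \<forall>n \<ge> 2 * (s - 2) + 2 * t.
    sat t n (complete_graph r) (complete_graph s)
      \<le> enat (((s - 2) choose (r - 1)) * 2 ^ (r - 1) * n + C) \<and>
    (\<exists>G :: nat pair_pre_digraph.
      pair_graph G \<and> card (pverts G) = n \<and> saturated (complete_graph s) G \<and> min_degree G = t \<and>
      card (copies (complete_graph r) G)
        \<le> ((s - 2) choose (r - 1)) * 2 ^ (r - 1) * n + C)"
proof -
  define k where "k = s - 2"
  define M where "M = (k choose (r - 1)) * 2 ^ (r - 1)"
  \<comment> \<open>The exponent is the least \<open>n\<close> for which \<open>t\<close> bulk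
    vertices fit. Below it there are at most \<open>2 ^ n\<close> cliques; from it on,
    \<open>card rest\<close> does not exceed the exponent.\<close>
  define C where "C = (2::nat) ^ (2 * t + 2 * k * k * t)"
  have s: "s = k + 2" and k: "2 \<le> k" and kt: "2 * k < t"
    using assms by (auto simp: k_def)
  have main: "\<exists>G :: nat pair_pre_digraph.
      pair_graph G \<and> card (pverts G) = n \<and> saturated (complete_graph s) G \<and> min_degree G = t \<and>
      card (copies (complete_graph r) G) \<le> M * n + C" if n: "2 * k + 2 * t \<le> n" for n
  proof (cases "n < 2 * t + 2 * k * k * t")
    case True
    obtain E where E: "simple_graph {..<n} E" "clique_saturated (k + 2) {..<n} E"
      "card (E `` {t}) = t" "\<And>v. v < n \<Longrightarrow> t \<le> card (E `` {v})"
      using complete_multipartite_saturated[of k t n] k n kt by auto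
    have "t \<in> {..<n}" using n k by simp
    have "card (cliques {..<n} E r) \<le> 2 ^ n" using card_cliques_le[of "{..<n}"] by simp
    also have "\<dots> \<le> C" unfolding C_def using True by (intro power_increasing) auto
    finally have "card (cliques {..<n} E r) \<le> M * n + C" by simp
    with ex_nat_pair_graph[OF E(1,2) \<open>t \<in> {..<n}\<close> E(3), of r] E(4) show ?thesis
      unfolding s by (metis card_lessThan lessThan_iff)
  next
    case False
    \<comment> \<open>All vertices beyond \<open>rest\<close> become bulk vertices, so that the
      total is exactly \<open>n\<close>.\<close>
    define m where "m = n - (t + 2 * k * k * t)"
    interpret core_bulk_graph k t "t - 2 * k" m
      using k kt False by unfold_locales (auto simp: m_def)
    obtain E where E: "E\<^sub>0 \<subseteq> E" "simple_graph V E" "clique_saturated (k + 2) V E"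
      using ex_clique_saturated_extension[OF simple_graph_E\<^sub>0 clique_free_E\<^sub>0] by blast
    then have free: "cliques V E (k + 2) = {}" by (simp add: clique_saturated_def)
    have "0 < m" using m_ge_t t_eq k by simp
    have "card V = n" using card_V(2) False by (simp add: m_def)
    have "card (cliques V E r) \<le> 2 ^ card rest + m * M"
      unfolding M_def by (rule card_cliques_E_le[OF E(1,2) free assms(1)])
    moreover have "2 ^ card rest \<le> C"
      unfolding C_def card_rest by (intro power_increasing) auto
    moreover have "m * M \<le> M * n" by (simp add: m_def)
    ultimately have "card (cliques V E r) \<le> M * n + C" by linarith
    moreover have "Bulk 0 \<in> V" "card (E `` {Bulk 0}) = t"
      using \<open>0 < m\<close> degree_bulk[OF E(1,2) free] by simp_all
    ultimately show ?thesis
      using ex_nat_pair_graph[OF E(2,3), of "Bulk 0" t r] degree_ge[OF E(1,2) free] \<open>card V = n\<close>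
      unfolding s by metis
  qed
  show ?thesis
    unfolding k_def[symmetric] M_def[symmetric]
  proof (intro exI[of _ C] allI impI conjI)
    fix n assume n: "2 * k + 2 * t \<le> n"
    from main[OF n] show "\<exists>G :: nat pair_pre_digraph.
      pair_graph G \<and> card (pverts G) = n \<and> saturated (complete_graph s) G \<and> min_degree G = t \<and>
      card (copies (complete_graph r) G) \<le> M * n + C" .
    then obtain G :: "nat pair_pre_digraph" where G: "G \<in> sat_graphs t n (complete_graph s)"
      and le: "card (copies (complete_graph r) G) \<le> M * n + C"
      by (auto simp: sat_graphs_def)
    have "sat t n (complete_graph r) (complete_graph s) \<le> enat (card (copies (complete_graph r) G))"
      unfolding sat_def by (rule INF_lower[OF G])
    also have "\<dots> \<le> enat (M * n + C)" using le by simp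
    finally show "sat t n (complete_graph r) (complete_graph s) \<le> enat (M * n + C)" .
  qed
qed

end
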